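(* Let $k>1$ be an integer. Every $k$-reverse multiple and every perfect $(\sigma,k)$-permutiple $[a_0;a_1,\ldots,a_n]$ is symmetric, i.e. $a_ja_{n-j}=a_{\sigma(j)}a_{\sigma(n-j)}$ for all $0\le j\le n$.
   Context: For positive integers $a_0,\ldots,a_n$, $[a_0;a_1,\ldots,a_n]$ denotes the finite simple continued fraction $a_0+1/(a_1+1/(\cdots+1/a_n))$; all finite continued fractions are assumed in canonical form (last digit at least $2$ when there are at least two digits). For an integer $k>1$ and a permutation $\sigma$ of $\{0,\ldots,n\}$, $r=[a_0;\ldots,a_n]$ is a $(\sigma,k)$-permutiple if $r=k\,[a_{\sigma(0)};a_{\sigma(1)},\ldots,a_{\sigma(n)}]$. A $k$-reverse multiple is a $(\sigma,k)$-permutiple with $\sigma(j)=n-j$ for all $j$. A $(\sigma,k)$-permutiple is perfect if $a_j=k\,a_{\sigma(j)}$ for every even $j$ and $a_{\sigma(j)}=k\,a_j$ for every odd $j$ ($0\le j\le n$). It is symmetric if $a_ja_{n-j}=a_{\sigma(j)}a_{\sigma(n-j)}$ for all $0\le j\le n$. *)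

theory Defs
  imports Complex_Main "HOL-Combinatorics.Permutations"
begin

text \<open>The value of the finite simple continued fraction with the given digits. The empty digit
  string denotes no continued fraction; its value is a dummy.\<close>

fun cf_value :: "nat list \<Rightarrow> real" where
  "cf_value [] = 0"
| "cf_value [x] = real x"
| "cf_value (x # y # ys) = real x + 1 / cf_value (y # ys)"

text \<open>A digit string of length \<open>n + 1\<close> is a function \<open>a\<close> on the naturals, of which only the values
  on \<open>{0..n}\<close> matter.\<close>

definition canonical_cf :: "nat \<Rightarrow> (nat \<Rightarrow> nat) \<Rightarrow> bool" where
  "canonical_cf n a \<longleftrightarrow> (\<forall>j\<le>n. a j > 0) \<and> (n \<ge> 1 \<longrightarrow> a n \<ge> 2)"

definition cf :: "nat \<Rightarrow> (nat \<Rightarrow> nat) \<Rightarrow> real" where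
  "cf n a = cf_value (map a [0..<Suc n])"

text \<open>Both continued fractions in the defining equation are taken in canonical form.\<close>

definition permutiple :: "nat \<Rightarrow> (nat \<Rightarrow> nat) \<Rightarrow> nat \<Rightarrow> (nat \<Rightarrow> nat) \<Rightarrow> bool" where
  "permutiple n \<sigma> k a \<longleftrightarrow>
     \<sigma> permutes {0..n} \<and> canonical_cf n a \<and> canonical_cf n (a \<circ> \<sigma>) \<and>
     cf n a = real k * cf n (a \<circ> \<sigma>)"

definition reverse_multiple :: "nat \<Rightarrow> (nat \<Rightarrow> nat) \<Rightarrow> nat \<Rightarrow> (nat \<Rightarrow> nat) \<Rightarrow> bool" where
  "reverse_multiple n \<sigma> k a \<longleftrightarrow> permutiple n \<sigma> k a \<and> (\<forall>j\<le>n. \<sigma> j = n - j)"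

definition perfect_permutiple :: "nat \<Rightarrow> (nat \<Rightarrow> nat) \<Rightarrow> nat \<Rightarrow> (nat \<Rightarrow> nat) \<Rightarrow> bool" where
  "perfect_permutiple n \<sigma> k a \<longleftrightarrow> permutiple n \<sigma> k a \<and>
     (\<forall>j\<le>n. (even j \<longrightarrow> a j = k * a (\<sigma> j)) \<and> (odd j \<longrightarrow> a (\<sigma> j) = k * a j))"

definition symmetric_permutiple :: "nat \<Rightarrow> (nat \<Rightarrow> nat) \<Rightarrow> nat \<Rightarrow> (nat \<Rightarrow> nat) \<Rightarrow> bool" where
  "symmetric_permutiple n \<sigma> k a \<longleftrightarrow> permutiple n \<sigma> k a \<and>
     (\<forall>j\<le>n. a j * a (n - j) = a (\<sigma> j) * a (\<sigma> (n - j)))"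

end

theory Submission
  imports Defs
begin

text \<open>Reversal swaps \<open>a\<^sub>j\<close> and \<open>a\<^sub>n\<^sub>-\<^sub>j\<close>, so reverse multiples are trivially symmetric. For a perfect
  permutiple, the products of all \<open>a\<^sub>j\<close> and of all \<open>a\<^bsub>\<sigma>(j)\<^esub>\<close> coincide, while passing from the second
  to the first contributes a factor \<open>k\<close> at each even index and \<open>1/k\<close> at each odd one. Hence there
  are as many even as odd indices, \<open>n\<close> is odd, and \<open>j\<close> and \<open>n - j\<close> have opposite parity, so that
  their two factors cancel.\<close>

text \<open>Each step of the induction adds an odd index and the next even one, whose factors
  \<open>k\<close> cancel; only index 0 leaves a \<open>k\<close> over. Writing \<open>k\<close> as
  a multiplier on either side avoids division.\<close>

lemma prod_alternating_scale:
  fixes f g :: "nat \<Rightarrow> 'a::comm_monoid_mult"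
  assumes "\<And>j. j \<le> 2 * m \<Longrightarrow> even j \<Longrightarrow> f j = k * g j"
    and "\<And>j. j \<le> 2 * m \<Longrightarrow> odd j \<Longrightarrow> g j = k * f j"
  shows "(\<Prod>j\<le>2 * m. f j) = k * (\<Prod>j\<le>2 * m. g j)"
  using assms
proof (induction m)
  case 0
  then show ?case by simp
next
  case (Suc m)
  have IH: "(\<Prod>j\<le>2 * m. f j) = k * (\<Prod>j\<le>2 * m. g j)"
    using Suc.prems by (intro Suc.IH) auto
  have "g (Suc (2 * m)) = k * f (Suc (2 * m))" "f (Suc (Suc (2 * m))) = k * g (Suc (Suc (2 * m)))"
    using Suc.prems by auto
  then show ?case
    using IH by (simp add: ac_simps)
qed

lemma perfect_permutiple_odd:
  assumes "k > 1" and "perfect_permutiple n \<sigma> k a"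
  shows "odd n"
proof
  assume "even n"
  then obtain m where n: "n = 2 * m" by (elim evenE)
  have perm: "\<sigma> permutes {..n}" and pos: "\<And>j. j \<le> n \<Longrightarrow> a j > 0"
    using assms(2)
    by (auto simp: perfect_permutiple_def permutiple_def canonical_cf_def atLeast0AtMost)
  have "(\<Prod>j\<le>n. a j) = k * (\<Prod>j\<le>n. a (\<sigma> j))"
    using assms(2) unfolding n perfect_permutiple_def by (intro prod_alternating_scale) auto
  also have "(\<Prod>j\<le>n. a (\<sigma> j)) = (\<Prod>j\<le>n. a j)"
    using prod.permute[OF perm, of a] by (simp add: o_def)
  finally have "(\<Prod>j\<le>n. a j) = k * (\<Prod>j\<le>n. a j)" .
  \<comment> \<open>For \<open>k > 1\<close>, only 0 equals \<open>k\<close> times itself; positive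
    digits exclude it.\<close>
  moreover have "(\<Prod>j\<le>n. a j) > 0"
    using pos by (simp add: prod_pos)
  ultimately show False
    using assms(1) n_less_m_mult_n[of "\<Prod>j\<le>n. a j" k] by linarith
qed

theorem theorem14:
  fixes k n :: nat and \<sigma> a :: "nat \<Rightarrow> nat"
  assumes "k > 1"
  shows "(reverse_multiple n \<sigma> k a \<longrightarrow> symmetric_permutiple n \<sigma> k a) \<and>
         (perfect_permutiple n \<sigma> k a \<longrightarrow> symmetric_permutiple n \<sigma> k a)"
proof (intro conjI impI)
  assume "reverse_multiple n \<sigma> k a"
  then show "symmetric_permutiple n \<sigma> k a"
    by (simp add: reverse_multiple_def symmetric_permutiple_def)
next
  assume perfect: "perfect_permutiple n \<sigma> k a"
  have "a j * a (n - j) = a (\<sigma> j) * a (\<sigma> (n - j))" if "j \<le> n" for j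
  proof -
    have "even (n - j) \<longleftrightarrow> odd j"
      using perfect_permutiple_odd[OF assms perfect] that by simp
    \<comment> \<open>Exactly one of \<open>j\<close> and \<open>n - j\<close> is even, so both
      sides equal \<open>k\<close> times the same product: \<open>a\<close> at the odd index times
      \<open>a \<circ> \<sigma>\<close> at the even one.\<close>
    then show ?thesis
      using perfect that by (cases "even j") (simp_all add: perfect_permutiple_def)
  qed
  then show "symmetric_permutiple n \<sigma> k a"
    using perfect by (simp add: perfect_permutiple_def symmetric_permutiple_def)
qed

end
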